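(* Let $V$ be a vector space over a field. Every right singular (equivalently, non-monomorphic) endomorphism of $V$ can be expressed as a product of projections if and only if $V$ is of finite dimension.
   Context: An element $s$ of the ring $S=\mathrm{End}(V)$ of linear endomorphisms is right singular if there is a nonzero $t\in S$ with $st=0$. A projection is an idempotent element of $S$. *)

theory Defs
  imports Complex_Main
begin

definition endomorphisms :: "('a::field \<Rightarrow> 'b::ab_group_add \<Rightarrow> 'b) \<Rightarrow> ('b \<Rightarrow> 'b) set" where
  "endomorphisms scale = {f. Vector_Spaces.linear scale scale f}"

text \<open>The multiplication of the endomorphism ring is composition, \<open>s t = s \<circ> t\<close>.\<close>

definition right_singular :: "('a::field \<Rightarrow> 'b::ab_group_add \<Rightarrow> 'b) \<Rightarrow> ('b \<Rightarrow> 'b) \<Rightarrow> bool" where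
  "right_singular scale s \<longleftrightarrow> s \<in> endomorphisms scale \<and>
     (\<exists>t \<in> endomorphisms scale. t \<noteq> (\<lambda>v. 0) \<and> s \<circ> t = (\<lambda>v. 0))"

definition projections :: "('a::field \<Rightarrow> 'b::ab_group_add \<Rightarrow> 'b) \<Rightarrow> ('b \<Rightarrow> 'b) set" where
  "projections scale = {p \<in> endomorphisms scale. p \<circ> p = p}"

definition product_of_projections :: "('a::field \<Rightarrow> 'b::ab_group_add \<Rightarrow> 'b) \<Rightarrow> ('b \<Rightarrow> 'b) \<Rightarrow> bool" where
  "product_of_projections scale s \<longleftrightarrow>
     (\<exists>ps. ps \<noteq> [] \<and> set ps \<subseteq> projections scale \<and> s = foldr (\<circ>) ps id)"

text \<open>The library's \<open>dim\<close> is \<open>0\<close> on infinite-dimensional spaces, so finiteness of the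
  dimension is expressed by the existence of a finite basis.\<close>

definition finite_dimensional :: "('a::field \<Rightarrow> 'b::ab_group_add \<Rightarrow> 'b) \<Rightarrow> bool" where
  "finite_dimensional scale \<longleftrightarrow> (\<exists>B. finite_dimensional_vector_space scale B)"

end

theory Submission imports Defs begin

text \<open>
  Both halves of the equivalence are elementary.

  In infinite dimension some endomorphism is surjective but not injective: a shift along an
  infinite basis that kills one basis vector. It is no product of projections. If such a product
  is surjective, then so is its leftmost factor, and a surjective projection is the identity;
  cancelling factors one by one (\<open>surjective_foldr_projections\<close>) shows that the product is the identity.

  In finite dimension, let \<open>s\<close> be singular with fixed space \<open>F = {v. s v = v}\<close>. If \<open>F\<close> contains the
  range of \<open>s\<close>, then \<open>s\<close> is itself a projection. Otherwise choose \<open>x\<close> in the range of \<open>s\<close> outside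
  \<open>F\<close>, and a nonzero \<open>k\<close> in the kernel, which is outside \<open>F\<close> too. Some linear functional \<open>\<phi>\<close>
  satisfies \<open>\<phi> F = 0\<close>, \<open>\<phi> k = 1\<close> and \<open>\<phi> x \<noteq> 0\<close>. The projection \<open>p v = v - \<phi>(v) k\<close> changes vectors
  only by elements of the kernel of \<open>s\<close> and maps into the kernel of \<open>\<phi>\<close>, so \<open>s = s' \<circ> p\<close> for every
  \<open>s' = s + \<phi>(_) u\<close>. All these maps fix \<open>F\<close>, and the choice \<open>u = (x - s x) / \<phi>(x)\<close> makes \<open>s'\<close>
  fix \<open>x\<close> as well. As \<open>u\<close> lies in the range of \<open>s\<close>, the map \<open>s'\<close> is again singular, and induction
  on the codimension of \<open>F\<close> applies.
\<close>

lemma foldr_comp_append: "foldr (\<circ>) (ps @ [p]) id = foldr (\<circ>) ps id \<circ> p"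
  by (induction ps) (simp_all add: comp_assoc)

lemma surjective_foldr_projections:
  assumes "set ps \<subseteq> projections scale" and "surj (foldr (\<circ>) ps id)"
  shows "foldr (\<circ>) ps id = id"
  using assms
proof (induction ps)
  case Nil
  show ?case by simp
next
  case (Cons p ps)
  have "surj p"
    using Cons.prems(2) by (auto simp: surj_def)
  moreover have "p (p v) = p v" for v
    using Cons.prems(1) by (auto simp: projections_def fun_eq_iff)
  ultimately have "p = id"
    by (metis eq_id_iff surjD)
  with Cons show ?case by simp
qed

context vector_space
begin

lemma endomorphisms_iff:
  "s \<in> endomorphisms scale \<longleftrightarrow>
    (\<forall>x y. s (x + y) = s x + s y) \<and> (\<forall>c x. s (scale c x) = scale c (s x))"
  using vector_space_axioms by (auto simp: endomorphisms_def Vector_Spaces.linear_iff)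

lemma functional_separating_point:
  assumes "subspace F" and "y \<notin> F"
  obtains \<phi> where "Vector_Spaces.linear scale (*) \<phi>" "\<And>v. v \<in> F \<Longrightarrow> \<phi> v = 0" "\<phi> y = 1"
proof -
  obtain C where C: "C \<subseteq> F" "independent C" "F \<subseteq> span C"
    using maximal_independent_subset .
  have "span C \<subseteq> F"
    using C(1) assms(1) by (rule span_minimal)
  with assms(2) have yC: "y \<notin> span C" by blast
  define B where "B = extend_basis (insert y C)"
  have ind: "independent (insert y C)"
    using yC C(2) by (rule independent_insertI)
  have B: "independent B" "span B = UNIV" "insert y C \<subseteq> B"
    using ind extend_basis_superset[OF ind] by (simp_all add: B_def independent_extend_basis)
  show ?thesis
  proof (rule that)
    show "Vector_Spaces.linear scale (*) (\<lambda>v. representation B v y)"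
      using B by (intro linear_representation)
    show "representation B y y = 1"
      using B by (simp add: representation_basis)
    show "representation B v y = 0" if "v \<in> F" for v
    proof -
      have "representation B v = representation C v"
        using B C that by (intro representation_extend) auto
      moreover have "y \<notin> C"
        using yC span_base by blast
      ultimately show ?thesis
        using representation_ne_zero by metis
    qed
  qed
qed

text \<open>Over any field, however small: if neither of the functionals that separate \<open>k\<close> and \<open>x\<close> from
  \<open>F\<close> is nonzero at both points, then their sum is.\<close>

lemma functional_separating_two_points:
  assumes F: "subspace F" and "k \<notin> F" and "x \<notin> F"
  obtains \<phi> where "Vector_Spaces.linear scale (*) \<phi>" "\<And>v. v \<in> F \<Longrightarrow> \<phi> v = 0" "\<phi> k = 1" "\<phi> x \<noteq> 0"
proof -
  obtain f where f: "Vector_Spaces.linear scale (*) f" "\<And>v. v \<in> F \<Longrightarrow> f v = 0" "f k = 1"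
    using functional_separating_point[OF F \<open>k \<notin> F\<close>] by metis
  obtain g where g: "Vector_Spaces.linear scale (*) g" "\<And>v. v \<in> F \<Longrightarrow> g v = 0" "g x = 1"
    using functional_separating_point[OF F \<open>x \<notin> F\<close>] by metis
  consider "f x \<noteq> 0" | "f x = 0" "g k = 0" | "g k \<noteq> 0" by blast
  then show ?thesis
  proof cases
    case 1
    with f show ?thesis by (intro that[of f])
  next
    case 2
    with f g show ?thesis
      by (intro that[of "\<lambda>v. f v + g v"]) (auto simp: Vector_Spaces.linear_iff algebra_simps)
  next
    case 3
    with g show ?thesis
      by (intro that[of "\<lambda>v. g v / g k"]) (auto simp: Vector_Spaces.linear_iff field_simps)
  qed
qed

lemma right_singular_iff_not_inj:
  assumes s: "s \<in> endomorphisms scale"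
  shows "right_singular scale s \<longleftrightarrow> \<not> inj s"
proof
  interpret s: Vector_Spaces.linear scale scale s
    using s by (simp add: endomorphisms_def)
  show "\<not> inj s" if "right_singular scale s"
  proof -
    obtain t :: "'b \<Rightarrow> 'b" where "t \<noteq> (\<lambda>v. 0)" "s \<circ> t = (\<lambda>v. 0)"
      using \<open>right_singular scale s\<close> unfolding right_singular_def by blast
    then obtain w where "t w \<noteq> 0" "s (t w) = 0"
      by (auto simp: fun_eq_iff)
    then show ?thesis
      using s.inj_iff_eq_0 by blast
  qed
  show "right_singular scale s" if "\<not> inj s"
  proof -
    obtain k where k: "s k = 0" "k \<noteq> 0"
      using \<open>\<not> inj s\<close> s.inj_iff_eq_0 by blast
    obtain \<phi> where \<phi>: "Vector_Spaces.linear scale (*) \<phi>" "\<phi> k = 1"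
      using functional_separating_point[OF subspace_single_0, of k] k by auto
    define t where "t = (\<lambda>v. scale (\<phi> v) k)"
    have "t \<in> endomorphisms scale"
      using \<phi>(1) by (simp add: endomorphisms_iff Vector_Spaces.linear_iff t_def scale_left_distrib)
    moreover have "t k \<noteq> 0"
      using k \<phi> by (simp add: t_def)
    then have "t \<noteq> (\<lambda>v. 0)" by auto
    moreover have "s \<circ> t = (\<lambda>v. 0)"
      using k by (simp add: t_def fun_eq_iff s.scale)
    ultimately show ?thesis
      using s by (auto simp: right_singular_def)
  qed
qed

lemma infinite_dimensional_surjective_not_injective:
  assumes "\<not> finite_dimensional scale"
  obtains s where "s \<in> endomorphisms scale" "surj s" "\<not> inj s"
proof -
  interpret vector_space_pair scale scale ..
  define B where "B = extend_basis {}"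
  have B: "independent B" "span B = UNIV"
    by (simp_all add: B_def independent_extend_basis independent_empty)
  have "infinite B"
  proof
    assume "finite B"
    with B have "finite_dimensional_vector_space scale B"
      by unfold_locales
    with assms show False by (auto simp: finite_dimensional_def)
  qed
  then obtain b where b: "b \<in> B"
    by (metis finite.emptyI ex_in_conv)
  obtain h where h: "bij_betw h B (B - {b})"
    using infinite_imp_bij_betw[OF \<open>infinite B\<close>] by blast
  define g where "g v = (if v = b then 0 else inv_into B h v)" for v
  obtain s where s: "Vector_Spaces.linear scale scale s" "\<forall>v\<in>B. s v = g v" "range s = span (g ` B)"
    using linear_independent_extend_subspace[OF B(1)] by blast
  have "v \<in> g ` B" if "v \<in> B" for v
  proof
    have "h v \<in> B - {b}" "inv_into B h (h v) = v"
      using h that by (auto simp: bij_betw_def)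
    then show "h v \<in> B" "v = g (h v)"
      by (auto simp: g_def)
  qed
  then have "span B \<subseteq> span (g ` B)"
    by (intro span_mono) blast
  with B s have "surj s" by auto
  moreover have "s b = s 0"
    using s(2) b linear_0[OF s(1)] by (simp add: g_def)
  moreover have "b \<noteq> 0"
    using B(1) b dependent_zero by blast
  ultimately show ?thesis
    using s that by (metis endomorphisms_def injD mem_Collect_eq)
qed

end

context finite_dimensional_vector_space
begin

text \<open>Each step splits off one projection on the right and enlarges the fixed space; the fixed
  space stays proper, because an endomorphism that fixes everything is injective.\<close>

lemma singular_imp_product_of_projections:
  assumes "s \<in> endomorphisms scale" and "\<not> inj s"
  shows "product_of_projections scale s"
  using assms
proof (induction "dimension - dim {v. s v = v}" arbitrary: s rule: less_induct)
  case less
  interpret s: Vector_Spaces.linear scale scale s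
    using less.prems by (simp add: endomorphisms_def)
  define F where "F = {v. s v = v}"
  have F: "subspace F"
    by (auto simp: F_def subspace_def s.add s.scale s.zero)
  show ?case
  proof (cases "range s \<subseteq> F")
    case True
    then have "s \<in> projections scale"
      using less.prems by (auto simp: projections_def F_def fun_eq_iff)
    then show ?thesis
      unfolding product_of_projections_def by (intro exI[of _ "[s]"]) simp
  next
    case False
    then obtain x where x: "x \<in> range s" "x \<notin> F" by blast
    obtain k where k: "s k = 0" "k \<noteq> 0"
      using less.prems s.inj_iff_eq_0 by blast
    have "k \<notin> F"
      using k by (simp add: F_def)
    from functional_separating_two_points[OF F this \<open>x \<notin> F\<close>]
    obtain \<phi> where \<phi>_lin: "Vector_Spaces.linear scale (*) \<phi>"
      and \<phi>: "\<And>v. v \<in> F \<Longrightarrow> \<phi> v = 0" "\<phi> k = 1" "\<phi> x \<noteq> 0"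
      by metis
    interpret \<phi>: Vector_Spaces.linear scale "(*)" \<phi> by (fact \<phi>_lin)
    define p where "p v = v - scale (\<phi> v) k" for v
    define u where "u = scale (inverse (\<phi> x)) (x - s x)"
    define s' where "s' v = s v + scale (\<phi> v) u" for v
    have \<phi>_p: "\<phi> (p v) = 0" for v
      using \<phi> by (simp add: p_def \<phi>.diff \<phi>.scale)
    have "p \<in> endomorphisms scale"
      by (simp add: endomorphisms_iff p_def \<phi>.add \<phi>.scale algebra_simps)
    moreover have "p (p v) = p v" for v
      using \<phi>_p[of v] by (simp add: p_def[of "p v"])
    ultimately have p: "p \<in> projections scale"
      by (auto simp: projections_def)
    have s': "s' \<in> endomorphisms scale"
      by (simp add: endomorphisms_iff s'_def s.add s.scale \<phi>.add \<phi>.scale algebra_simps)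
    have factor: "s = s' \<circ> p"
      using k by (simp add: fun_eq_iff s'_def \<phi>_p) (simp add: p_def s.diff s.scale)
    have "subspace (range s)"
      using s.subspace_image[OF subspace_UNIV] .
    then have "u \<in> range s"
      unfolding u_def using x by (intro subspace_scale subspace_diff) auto
    then have "range s' \<subseteq> range s"
      using \<open>subspace (range s)\<close> by (auto simp: s'_def intro!: subspace_add subspace_scale)
    \<comment> \<open>The kernel of \<open>s'\<close> need not contain \<open>k\<close> any more; only the range is controlled, so
      singularity of \<open>s'\<close> has to come from non-surjectivity, which takes finite dimension.\<close>
    moreover have "\<not> surj s"
      using linear_surj_imp_inj s.linear_axioms less.prems by blast
    ultimately have "\<not> surj s'" by blast
    then have not_inj: "\<not> inj s'"
      using linear_inj_imp_surj s' by (auto simp: endomorphisms_def)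
    interpret s': Vector_Spaces.linear scale scale s'
      using s' by (simp add: endomorphisms_def)
    define F' where "F' = {v. s' v = v}"
    have F': "subspace F'"
      by (auto simp: F'_def subspace_def s'.add s'.scale s'.zero)
    have "F \<subseteq> F'"
      using \<phi> by (auto simp: F'_def s'_def F_def)
    moreover have "x \<in> F'"
      using \<phi> by (simp add: F'_def s'_def u_def)
    ultimately have "F \<subset> F'"
      using x by blast
    then have "span F \<subset> span F'"
      using F F' by (simp add: span_eq_iff[THEN iffD2])
    then have "dim F < dim F'"
      by (rule dim_psubset)
    with dim_subset_UNIV[of F'] have "dimension - dim F' < dimension - dim F" by linarith
    then have "product_of_projections scale s'"
      using less.hyps s' not_inj by (simp add: F_def F'_def)
    then obtain ps where "set ps \<subseteq> projections scale" "s' = foldr (\<circ>) ps id"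
      by (auto simp: product_of_projections_def)
    with p factor have "set (ps @ [p]) \<subseteq> projections scale" "s = foldr (\<circ>) (ps @ [p]) id"
      unfolding foldr_comp_append by auto
    then show ?thesis
      unfolding product_of_projections_def by blast
  qed
qed

end

theorem mainTheorem7:
  fixes scale :: "'a::field \<Rightarrow> 'b::ab_group_add \<Rightarrow> 'b"
  assumes "vector_space scale"
  shows "(\<forall>s \<in> endomorphisms scale. right_singular scale s \<longleftrightarrow> \<not> inj s) \<and>
    ((\<forall>s \<in> endomorphisms scale. right_singular scale s \<longrightarrow> product_of_projections scale s)
      \<longleftrightarrow> finite_dimensional scale)"
proof -
  interpret vector_space scale by fact
  have "\<exists>s \<in> endomorphisms scale. \<not> inj s \<and> \<not> product_of_projections scale s"
    if infinite: "\<not> finite_dimensional scale"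
  proof -
    obtain s where s: "s \<in> endomorphisms scale" "surj s" "\<not> inj s"
      using infinite_dimensional_surjective_not_injective[OF infinite] .
    have "s = id" if "product_of_projections scale s"
      using that s(2) surjective_foldr_projections by (auto simp: product_of_projections_def)
    with s show ?thesis by auto
  qed
  moreover have "product_of_projections scale s"
    if "finite_dimensional scale" "s \<in> endomorphisms scale" "\<not> inj s" for s
    using that finite_dimensional_vector_space.singular_imp_product_of_projections
    by (auto simp: finite_dimensional_def)
  ultimately show ?thesis
    using right_singular_iff_not_inj by blast
qed

end
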